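(* Let $N$ be a positive integer. The unique (up to translation) smallest polyomino which contains at least $N^2$ instances of the T tetromino is the ziggurat of height $N+1$.
   Context: Cells are the unit squares of the square lattice, indexed by integer coordinates $(x,y)$ with $y$ increasing upward. A polyomino is a finite nonempty edge-connected set of cells; its size is its number of cells; polyominoes are considered up to translation. The T tetromino is the set $\{(-1,0),(0,0),(1,0),(0,1)\}$ (three cells in a row with one cell directly above the middle one); only this orientation is considered. An instance of a shape is a translate of it; an instance in $P$ is one contained in $P$. The ziggurat of height $M$ is the polyomino whose rows, from top to bottom, consist of $1,3,5,\dots,2M-1$ consecutive cells, all centered on a common vertical axis (i.e., rows $\{(x,-j): |x|\le j\}$ for $j=0,\dots,M-1$); it has $M^2$ cells. *)

theory Defs
  imports Main "HOL-Library.Product_Plus"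
begin

text \<open>The cell with coordinates \<open>(x, y)\<close> has its neighbours above and to the right at
  \<open>(x, y + 1)\<close> and \<open>(x + 1, y)\<close>.\<close>

type_synonym cell = "int \<times> int"

definition adjacent :: "cell \<Rightarrow> cell \<Rightarrow> bool" where
  "adjacent c d \<longleftrightarrow> \<bar>fst c - fst d\<bar> + \<bar>snd c - snd d\<bar> = 1"

definition edge_connected :: "cell set \<Rightarrow> bool" where
  "edge_connected P \<longleftrightarrow>
     (\<forall>c\<in>P. \<forall>d\<in>P. (c, d) \<in> {(a, b). a \<in> P \<and> b \<in> P \<and> adjacent a b}\<^sup>*)"

text \<open>Polyominoes are represented by concrete sets of cells; identification up to translation is
  made explicit through \<open>translate\<close> where it matters. The size is \<open>card\<close>.\<close>

definition polyomino :: "cell set \<Rightarrow> bool" where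
  "polyomino P \<longleftrightarrow> finite P \<and> P \<noteq> {} \<and> edge_connected P"

definition translate :: "cell \<Rightarrow> cell set \<Rightarrow> cell set" where
  "translate v S = (\<lambda>c. v + c) ` S"

definition instances_in :: "cell set \<Rightarrow> cell set \<Rightarrow> cell set set" where
  "instances_in S P = {I. (\<exists>v. I = translate v S) \<and> I \<subseteq> P}"

definition T_tetromino :: "cell set" where
  "T_tetromino = {(-1, 0), (0, 0), (1, 0), (0, 1)}"

definition ziggurat :: "nat \<Rightarrow> cell set" where
  "ziggurat M = {(x, - int j) | x j. j < M \<and> \<bar>x\<bar> \<le> int j}"

definition smallest_containing :: "cell set \<Rightarrow> nat \<Rightarrow> cell set \<Rightarrow> bool" where
  "smallest_containing S k P \<longleftrightarrow>
     polyomino P \<and> card (instances_in S P) \<ge> k \<and>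
     (\<forall>Q. polyomino Q \<and> card (instances_in S Q) \<ge> k \<longrightarrow> card P \<le> card Q)"

end

theory Submission
  imports Defs
begin

text \<open>Cut the polyomino into horizontal rows, listed from top to bottom; let row \<open>i\<close> have \<open>p\<^sub>i\<close> cells,
  \<open>a\<^sub>i\<close> of which are centres of a T tetromino. Then \<open>p\<^sub>i \<ge> a\<^sub>i + 2\<close> if \<open>a\<^sub>i > 0\<close>, and \<open>p\<^sub>i \<ge> a\<^sub>i\<^sub>+\<^sub>1\<close>
  because the cell above a centre belongs to the polyomino. Let \<open>h\<close> be the number of rows with \<open>a\<^sub>i > 0\<close> and
  write the total size as \<open>S + 2 h + E\<close> with \<open>S\<close> the number of centres. Telescoping bounds the
  number of centres in a row below \<open>k\<close> other nonempty ones by \<open>E + 2 k\<close>, so \<open>S \<le> h (h - 1 + E)\<close>,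
  and AM-GM gives \<open>2 h + E \<ge> 2 \<surd>S + 1\<close>. In the case of equality \<open>E = 1\<close>, and the
  nonempty rows of centres have lengths \<open>1, 3, 5, \<dots>\<close>, each filling the row of the polyomino above it.\<close>

section \<open>Inequalities for a sequence of rows of cells and centres\<close>

locale rows =
  fixes A P :: "nat \<Rightarrow> int set"
  assumes fin: "finite (P i)"
    and centre: "x \<in> A i \<Longrightarrow> {x - 1, x, x + 1} \<subseteq> P i"
    and above: "A (Suc i) \<subseteq> P i"
    and top: "A 0 = {}"
begin

definition h :: "nat \<Rightarrow> int" where
  "h n = (\<Sum>i<n. of_bool (A i \<noteq> {}))"

definition S :: "nat \<Rightarrow> int" where
  "S n = (\<Sum>i<n. int (card (A i)))"

definition E :: "nat \<Rightarrow> int" where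
  "E n = (\<Sum>i<n. int (card (P i))) - S n - 2 * h n"

text \<open>Its nonnegativity is the bound on \<open>S n\<close>. It is monotone from 0, so a final
  value 0 forces 0 at every earlier row; the equality case rests on this.\<close>

definition slack :: "nat \<Rightarrow> int" where
  "slack n = h n * (h n - 1 + E n) - S n"

lemma h_0: "h 0 = 0" and S_0: "S 0 = 0" and E_0: "E 0 = 0"
  by (simp_all add: h_def S_def E_def)

lemma h_Suc: "h (Suc n) = h n + of_bool (A n \<noteq> {})"
  and S_Suc: "S (Suc n) = S n + int (card (A n))"
  and E_Suc: "E (Suc n) = E n + (int (card (P n)) - int (card (A n)) - 2 * of_bool (A n \<noteq> {}))"
  by (simp_all add: h_def S_def E_def)

lemma h_nonneg: "0 \<le> h n"
  by (simp add: h_def sum_nonneg)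

lemma fin_A: "finite (A i)"
  using centre fin[of i] by (meson finite_subset insert_subset subsetI)

text \<open>The left neighbour of the leftmost centre and the right neighbour of the rightmost one
  are cells but not centres.\<close>

lemma card_A_le: "int (card (A i)) + 2 * of_bool (A i \<noteq> {}) \<le> int (card (P i))"
proof (cases "A i = {}")
  case False
  let ?B = "insert (Max (A i) + 1) (insert (Min (A i) - 1) (A i))"
  have "Max (A i) \<in> A i" "Min (A i) \<in> A i"
    using False fin_A by simp_all
  then have "?B \<subseteq> P i"
    using centre by blast
  then have le: "card ?B \<le> card (P i)"
    using fin card_mono by blast
  have "Min (A i) - 1 \<notin> A i"
    using Min_le[OF fin_A, of "Min (A i) - 1" i] by linarith
  moreover have "Max (A i) + 1 \<notin> A i"
    using Max_ge[OF fin_A, of "Max (A i) + 1" i] by linarith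
  moreover have "Max (A i) + 1 \<noteq> Min (A i) - 1"
    using Min_le[OF fin_A \<open>Max (A i) \<in> A i\<close>] by linarith
  ultimately have "card ?B = card (A i) + 2"
    using fin_A by simp
  with le False show ?thesis
    by simp
qed simp

lemma E_mono: "m \<le> n \<Longrightarrow> E m \<le> E n"
  by (rule lift_Suc_mono_le[of E]) (use card_A_le in \<open>auto simp: E_Suc algebra_simps\<close>)

text \<open>\<open>E n + 2 * h n\<close> is the sum of \<open>card (P i) - card (A i)\<close> over
  \<open>i < n\<close>; it telescopes, since each row of cells is at least as large as the next row
  of centres and \<open>A 0\<close> is empty.\<close>

lemma card_A_le_E: "int (card (A n)) \<le> E n + 2 * h n"
proof (induction n)
  case 0
  then show ?case
    by (simp add: top E_0 h_0)
next
  case (Suc n)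
  have "card (A (Suc n)) \<le> card (P n)"
    using above fin card_mono by blast
  with Suc show ?case
    by (simp add: E_Suc h_Suc algebra_simps)
qed

text \<open>With d the growth of \<open>E\<close>, an empty row of centres adds
  \<open>h n * d\<close>; any other row adds \<open>(h n + 1) * d\<close> plus the gap in
  \<open>card_A_le_E\<close>.\<close>

lemma slack_Suc: "slack n \<le> slack (Suc n)"
proof (cases "A n = {}")
  case True
  have "h n * E n \<le> h n * E (Suc n)"
    using E_mono[of n "Suc n"] h_nonneg by (simp add: mult_left_mono)
  then show ?thesis
    using True by (simp add: slack_def h_Suc S_Suc algebra_simps)
next
  case False
  have "(h n + 1) * E n \<le> (h n + 1) * E (Suc n)"
    using E_mono[of n "Suc n"] h_nonneg[of n] by (simp add: mult_left_mono)
  then show ?thesis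
    using False card_A_le_E[of n] by (simp add: slack_def h_Suc S_Suc algebra_simps)
qed

lemma slack_mono: "m \<le> n \<Longrightarrow> slack m \<le> slack n"
  using lift_Suc_mono_le[of slack] slack_Suc by blast

lemma slack_nonneg: "0 \<le> slack n"
  using slack_mono[of 0 n] by (simp add: slack_def h_0 S_0)

lemma sum_card_P: "(\<Sum>i<n. int (card (P i))) = S n + 2 * h n + E n"
  by (simp add: E_def)

lemma two_h_add_E_ge:
  fixes N :: int
  assumes "N > 0" and "S n \<ge> N\<^sup>2"
  shows "2 * h n + E n \<ge> 2 * N + 1"
proof (rule ccontr)
  assume "\<not> ?thesis"
  then have "h n * (h n - 1 + E n) \<le> h n * (2 * N - 1 - h n)"
    using h_nonneg[of n] by (intro mult_left_mono) auto
  then have "N\<^sup>2 \<le> h n * (2 * N - 1 - h n)"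
    using slack_nonneg[of n] assms by (simp add: slack_def)
  \<comment> \<open>Completing the square: the product is at most a quarter of
    \<open>(2 * N - 1)\<^sup>2\<close>, which is less than \<open>N\<^sup>2\<close>.\<close>
  moreover have "4 * (h n * (2 * N - 1 - h n)) = (2 * N - 1)\<^sup>2 - (2 * N - 1 - 2 * h n)\<^sup>2"
    by (simp add: power2_eq_square algebra_simps)
  moreover have "(2 * N - 1)\<^sup>2 = 4 * N\<^sup>2 - 4 * N + 1"
    by (simp add: power2_eq_square algebra_simps)
  moreover have "0 \<le> (2 * N - 1 - 2 * h n)\<^sup>2"
    by simp
  ultimately show False
    using \<open>N > 0\<close> by linarith
qed

lemma sum_card_P_ge:
  fixes N :: int
  assumes "N > 0" and "S n \<ge> N\<^sup>2"
  shows "(\<Sum>i<n. int (card (P i))) \<ge> (N + 1)\<^sup>2"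
  using two_h_add_E_ge[OF assms] assms(2) sum_card_P[of n] by (simp add: power2_eq_square algebra_simps)

section \<open>The case of equality\<close>

lemma tight_parameters:
  fixes N :: int
  assumes "N > 0" and "S n \<ge> N\<^sup>2" and eq: "(\<Sum>i<n. int (card (P i))) = (N + 1)\<^sup>2"
  shows "h n = N" and "E n = 1" and "slack n = 0"
proof -
  have *: "(N + 1)\<^sup>2 = N\<^sup>2 + 2 * N + 1"
    by (simp add: power2_eq_square algebra_simps)
  \<comment> \<open>The size splits as \<open>N\<^sup>2\<close> plus \<open>2 * N + 1\<close>, lower
    bounds for \<open>S n\<close> and \<open>2 * h n + E n\<close>, so both are attained.\<close>
  have S: "S n = N\<^sup>2" and hE: "E n = 2 * N + 1 - 2 * h n"
    using two_h_add_E_ge[OF assms(1,2)] assms(2) eq sum_card_P[of n] * by linarith+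
  have slack: "slack n = - (N - h n)\<^sup>2"
    by (simp add: slack_def S hE power2_eq_square algebra_simps)
  then have "(N - h n)\<^sup>2 \<le> 0"
    using slack_nonneg[of n] by linarith
  then show "h n = N"
    by simp
  with hE slack show "E n = 1" "slack n = 0"
    by simp_all
qed

lemma tight_rows:
  fixes N :: nat
  assumes "N > 0" and "S n \<ge> (int N)\<^sup>2" and eq: "(\<Sum>i<n. int (card (P i))) = (int N + 1)\<^sup>2"
  obtains m c where "0 < m" and "\<And>k. k < N \<Longrightarrow> A (m + k) = {c - int k..c + int k}"
proof -
  note tight = tight_parameters[OF _ assms(2,3)]
  have hn: "h n = int N" and En: "E n = 1" and sn: "slack n = 0"
    using tight assms(1) by simp_all
  have slack0: "slack i = 0" if "i \<le> n" for i
    using slack_mono[OF that] slack_nonneg[of i] sn by linarith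
  have "\<exists>i<n. A i \<noteq> {}"
  proof (rule ccontr)
    assume "\<not> ?thesis"
    then have "h n = 0"
      by (simp add: h_def)
    then show False
      using hn assms(1) by simp
  qed
  then obtain i where i: "i < n" "A i \<noteq> {}"
    by blast
  define m where "m = (LEAST i. A i \<noteq> {})"
  have Am: "A m \<noteq> {}"
    unfolding m_def using i(2) by (rule LeastI)
  have below: "A j = {}" if "j < m" for j
    using not_less_Least[OF that[unfolded m_def]] by simp
  have "m \<le> i"
    unfolding m_def using i(2) by (rule Least_le)
  then have "m < n"
    using i(1) by simp
  have "0 < m"
    using Am top by (metis gr0I)
  have hm: "h m = 0"
    using below by (simp add: h_def)
  have "card (A m) > 0"
    using Am fin_A card_gt_0_iff by blast
  \<comment> \<open>No row above \<open>m\<close> has centres, so \<open>card_A_le_E\<close> reads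
    \<open>card (A m)\<close> \<le> \<open>E m\<close>. Hence \<open>E\<close> has its final value 1
    from row \<open>m\<close> on.\<close>
  then have "E m \<ge> 1"
    using card_A_le_E[of m] hm by linarith
  then have E1: "E i = 1" if "m \<le> i" "i \<le> n" for i
    using E_mono[OF that(1)] E_mono[OF that(2)] En by linarith
  have S_eq: "S i = h i * h i" if "m \<le> i" "i \<le> n" for i
    using slack0[of i] E1[OF that] that by (simp add: slack_def)
  have cardP: "int (card (P i)) = int (card (A i)) + 2 * of_bool (A i \<noteq> {})" if "m \<le> i" "i < n" for i
    using E1[of i] E1[of "Suc i"] E_Suc[of i] that by simp
  \<comment> \<open>\<open>S\<close> runs through the squares of \<open>h\<close>, so a nonempty row
    adds the difference of consecutive squares.\<close>
  have cardA: "int (card (A i)) = 2 * h i + 1" if "m \<le> i" "i < n" "A i \<noteq> {}" for i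
    using S_eq[of i] S_eq[of "Suc i"] S_Suc[of i] h_Suc[of i] that by (simp add: algebra_simps)
  \<comment> \<open>With no excess left, a row without centres has no cells, so the row below has no
    centres either, and so on down.\<close>
  have stop: "h n = h i" if "m \<le> i" "i < n" "A i = {}" for i
  proof -
    have empty: "A j = {}" if "i \<le> j" "j < n" for j
      using that
    proof (induction j rule: dec_induct)
      case (step j)
      then have "P j = {}"
        using cardP[of j] \<open>m \<le> i\<close> fin[of j] by simp
      then show ?case
        using above[of j] by simp
    qed (use \<open>A i = {}\<close> in simp)
    have "h j = h i" if "i \<le> j" "j \<le> n" for j
      using that by (induction j rule: dec_induct) (simp_all add: h_Suc empty)
    from this[of n] show ?thesis
      using \<open>i < n\<close> by simp
  qed
  obtain c where c: "A m = {c}"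
  proof -
    have "card (A m) = 1"
      using cardA[of m] Am hm \<open>m < n\<close> by simp
    then show ?thesis
      by (rule card_1_singletonE) (rule that)
  qed
  have "A (m + k) = {c - int k..c + int k} \<and> h (m + k) = int k \<and> m + k < n" if "k < N" for k
    using that
  proof (induction k)
    case 0
    then show ?case
      using c hm \<open>m < n\<close> by simp
  next
    case (Suc k)
    let ?i = "m + k"
    have Ai: "A ?i = {c - int k..c + int k}" and hi: "h ?i = int k" and "?i < n"
      using Suc by simp_all
    then have ne: "A ?i \<noteq> {}"
      by simp
    have h': "h (Suc ?i) = int k + 1"
      using ne hi by (simp add: h_Suc)
    have "Suc ?i \<noteq> n"
      using h' hn Suc.prems by auto
    then have "Suc ?i < n"
      using \<open>?i < n\<close> by simp
    \<comment> \<open>Each point of the wider interval is a centre or next to one.\<close>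
    have sub: "{c - int (Suc k)..c + int (Suc k)} \<subseteq> P ?i"
    proof
      fix x
      assume "x \<in> {c - int (Suc k)..c + int (Suc k)}"
      then have "x - 1 \<in> A ?i \<or> x \<in> A ?i \<or> x + 1 \<in> A ?i"
        unfolding Ai by auto
      then show "x \<in> P ?i"
        using centre[of "x - 1"] centre[of x] centre[of "x + 1"] by auto
    qed
    have "card (P ?i) = 2 * k + 3"
      using cardP[of ?i] ne \<open>?i < n\<close> Ai by simp
    then have Pi: "P ?i = {c - int (Suc k)..c + int (Suc k)}"
      using card_subset_eq[OF fin sub] by simp
    \<comment> \<open>Otherwise \<open>stop\<close> would freeze \<open>h\<close> at
      \<open>k + 1\<close>, short of its final value \<open>N\<close>.\<close>
    have "A (Suc ?i) \<noteq> {}"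
      using stop[of "Suc ?i"] \<open>Suc ?i < n\<close> h' hn Suc.prems by auto
    then have "int (card (A (Suc ?i))) = 2 * (int k + 1) + 1"
      using cardA[of "Suc ?i"] \<open>Suc ?i < n\<close> h' by simp
    then have "card (A (Suc ?i)) = card (P ?i)"
      using \<open>card (P ?i) = 2 * k + 3\<close> by simp
    then have "A (Suc ?i) = P ?i"
      by (rule card_subset_eq[OF fin above])
    then show ?case
      using Pi h' \<open>Suc ?i < n\<close> by simp
  qed
  then show thesis
    using that \<open>0 < m\<close> by blast
qed

end

section \<open>Instances of the T tetromino, indexed by their centres\<close>

definition T_centres :: "cell set \<Rightarrow> cell set" where
  "T_centres P = {(x, y). {(x - 1, y), (x, y), (x + 1, y), (x, y + 1)} \<subseteq> P}"

lemma translate_T: "translate (x, y) T_tetromino = {(x - 1, y), (x, y), (x + 1, y), (x, y + 1)}"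
  by (simp add: translate_def T_tetromino_def)

lemma instances_in_T: "instances_in T_tetromino P = (\<lambda>v. translate v T_tetromino) ` T_centres P"
proof (intro equalityI subsetI)
  fix I
  assume "I \<in> instances_in T_tetromino P"
  then obtain x y where "I = translate (x, y) T_tetromino" "I \<subseteq> P"
    unfolding instances_in_def by auto
  then show "I \<in> (\<lambda>v. translate v T_tetromino) ` T_centres P"
    unfolding T_centres_def translate_T by (intro image_eqI[of _ _ "(x, y)"]) (simp_all add: translate_T)
next
  fix I
  assume "I \<in> (\<lambda>v. translate v T_tetromino) ` T_centres P"
  then show "I \<in> instances_in T_tetromino P"
    unfolding instances_in_def T_centres_def by (auto simp: translate_T) (metis translate_T)
qed

lemma inj_translate_T: "inj (\<lambda>v. translate v T_tetromino)"
proof (rule injI)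
  fix v w :: cell
  assume eq: "translate v T_tetromino = translate w T_tetromino"
  obtain x y x' y' where [simp]: "v = (x, y)" "w = (x', y')"
    by (metis surj_pair)
  \<comment> \<open>Two cells of an instance that lie in one row at distance 2 can only be the ends
    of its bar, and these determine the centre.\<close>
  have "(x - 1, y) \<in> translate w T_tetromino" "(x + 1, y) \<in> translate w T_tetromino"
    using eq[symmetric] by (simp_all add: translate_T)
  then show "v = w"
    by (auto simp: translate_T)
qed

lemma card_instances_in_T: "card (instances_in T_tetromino P) = card (T_centres P)"
  unfolding instances_in_T using card_image inj_on_subset[OF inj_translate_T] by blast

section \<open>Size, connectedness and centres of the ziggurat\<close>

lemma ziggurat_iff: "(x, y) \<in> ziggurat M \<longleftrightarrow> - int M < y \<and> y \<le> 0 \<and> \<bar>x\<bar> \<le> - y"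
proof
  assume "- int M < y \<and> y \<le> 0 \<and> \<bar>x\<bar> \<le> - y"
  then show "(x, y) \<in> ziggurat M"
    unfolding ziggurat_def by (simp, intro exI[of _ "nat (- y)"]) auto
qed (auto simp: ziggurat_def)

lemma ziggurat_Suc: "ziggurat (Suc M) = ziggurat M \<union> {- int M..int M} \<times> {- int M}"
  by (auto simp: ziggurat_iff)

lemma finite_ziggurat: "finite (ziggurat M)"
  by (induction M) (simp_all add: ziggurat_Suc, simp add: ziggurat_def)

lemma card_ziggurat: "card (ziggurat M) = M\<^sup>2"
proof (induction M)
  case 0
  then show ?case
    by (simp add: ziggurat_def)
next
  case (Suc M)
  have "ziggurat M \<inter> {- int M..int M} \<times> {- int M} = {}"
    by (auto simp: ziggurat_iff)
  then have "card (ziggurat (Suc M)) = card (ziggurat M) + card ({- int M..int M} \<times> {- int M})"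
    unfolding ziggurat_Suc by (intro card_Un_disjoint) (simp_all add: finite_ziggurat)
  also have "card ({- int M..int M} \<times> {- int M}) = 2 * M + 1"
    by simp
  finally show ?case
    using Suc by (simp add: power2_eq_square)
qed

lemma edge_connectedI:
  assumes "\<And>c. c \<in> P \<Longrightarrow> (c, r) \<in> {(a, b). a \<in> P \<and> b \<in> P \<and> adjacent a b}\<^sup>*"
  shows "edge_connected P"
proof -
  let ?R = "{(a, b). a \<in> P \<and> b \<in> P \<and> adjacent a b}"
  have "sym ?R"
    by (auto simp: sym_def adjacent_def abs_minus_commute)
  then have "sym (?R\<^sup>*)"
    by (rule sym_rtrancl)
  then show ?thesis
    unfolding edge_connected_def using assms by (meson rtrancl_trans symD)
qed

text \<open>Every cell is joined to the apex: along its row to the axis, then up the axis.\<close>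

lemma polyomino_ziggurat:
  assumes "M > 0"
  shows "polyomino (ziggurat M)"
proof -
  let ?R = "{(a, b). a \<in> ziggurat M \<and> b \<in> ziggurat M \<and> adjacent a b}"
  have column: "((0, - int j), (0, 0)) \<in> ?R\<^sup>*" if "j < M" for j
    using that
  proof (induction j)
    case (Suc j)
    have "((0, - int (Suc j)), (0, - int j)) \<in> ?R"
      using Suc.prems by (simp add: ziggurat_iff adjacent_def)
    then show ?case
      using Suc by (meson Suc_lessD converse_rtrancl_into_rtrancl)
  qed simp
  \<comment> \<open>The sign \<open>s\<close> selects the side of the axis, so one induction on the
    distance \<open>k\<close> serves both.\<close>
  have row: "((s * int k, - int j), (0, - int j)) \<in> ?R\<^sup>*" if "j < M" "k \<le> j" "s = 1 \<or> s = - 1"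
    for j k and s :: int
    using that(2)
  proof (induction k)
    case (Suc k)
    have "((s * int (Suc k), - int j), (s * int k, - int j)) \<in> ?R"
      using Suc.prems that(1,3) by (auto simp: ziggurat_iff adjacent_def)
    then show ?case
      using Suc by (meson Suc_leD converse_rtrancl_into_rtrancl)
  qed simp
  have "(c, (0, 0)) \<in> ?R\<^sup>*" if "c \<in> ziggurat M" for c
  proof -
    obtain x j where c: "c = (x, - int j)" "j < M" "\<bar>x\<bar> \<le> int j"
      using \<open>c \<in> ziggurat M\<close> unfolding ziggurat_def by auto
    have "x = (if x \<ge> 0 then 1 else - 1) * int (nat \<bar>x\<bar>)"
      by simp
    then have "(c, (0, - int j)) \<in> ?R\<^sup>*"
      using row[OF \<open>j < M\<close>, of "nat \<bar>x\<bar>" "if x \<ge> 0 then 1 else - 1"] c by auto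
    then show ?thesis
      using column[OF \<open>j < M\<close>] by (rule rtrancl_trans)
  qed
  then have "edge_connected (ziggurat M)"
    by (rule edge_connectedI)
  moreover have "(0, 0) \<in> ziggurat M"
    using assms by (simp add: ziggurat_iff)
  ultimately show ?thesis
    unfolding polyomino_def using finite_ziggurat by blast
qed

lemma card_translate: "card (translate v S) = card S"
  unfolding translate_def by (intro card_image) (simp add: inj_on_def)

text \<open>Only the two ends of each row fail to be centres (for the top row, its single
  cell).\<close>

lemma T_centres_ziggurat: "T_centres (ziggurat (N + 1)) = translate (0, - 1) (ziggurat N)"
proof (intro set_eqI)
  fix c :: cell
  obtain x y where [simp]: "c = (x, y)"
    by force
  have "c \<in> translate (0, - 1) (ziggurat N) \<longleftrightarrow> (x, y + 1) \<in> ziggurat N"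
    unfolding translate_def by force
  then show "c \<in> T_centres (ziggurat (N + 1)) \<longleftrightarrow> c \<in> translate (0, - 1) (ziggurat N)"
    by (auto simp: T_centres_def ziggurat_iff)
qed

section \<open>Slicing a finite set of cells into rows\<close>

lemma sum_card_rows:
  fixes B :: "cell set" and t :: int
  assumes "finite B" and "\<And>x y. (x, y) \<in> B \<Longrightarrow> t - int n < y \<and> y \<le> t"
  shows "(\<Sum>i<n. card {x. (x, t - int i) \<in> B}) = card B"
proof -
  have inj: "inj_on (\<lambda>(i, x). (x, t - int i)) X" for X
    by (auto simp: inj_on_def)
  have "B = (\<lambda>(i, x). (x, t - int i)) ` (SIGMA i:{..<n}. {x. (x, t - int i) \<in> B})"
  proof (intro equalityI subsetI)
    fix c
    assume "c \<in> B"
    moreover obtain x y where [simp]: "c = (x, y)"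
      by force
    ultimately show "c \<in> (\<lambda>(i, x). (x, t - int i)) ` (SIGMA i:{..<n}. {x. (x, t - int i) \<in> B})"
      using assms(2)[of x y] by (intro image_eqI[of _ _ "(nat (t - y), x)"]) auto
  qed auto
  then have "card B = card (SIGMA i:{..<n}. {x. (x, t - int i) \<in> B})"
    using card_image[OF inj] by metis
  moreover have "finite {x. (x, t - int i) \<in> B}" for i
    by (rule finite_subset[of _ "fst ` B"]) (use assms(1) in \<open>force+\<close>)
  ultimately show ?thesis
    by simp
qed

lemma finite_T_centres: "finite P \<Longrightarrow> finite (T_centres P)"
  by (rule finite_subset[of _ P]) (auto simp: T_centres_def)

lemma card_ge_of_T_centres:
  assumes "finite P" and "N > 0" and "card (T_centres P) \<ge> N\<^sup>2"
  shows "card P \<ge> (N + 1)\<^sup>2"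
    and "card P = (N + 1)\<^sup>2 \<Longrightarrow> \<exists>v. P = translate v (ziggurat (N + 1))"
proof -
  have "bdd_above (snd ` P)" "bdd_below (snd ` P)"
    using assms(1) by simp_all
  then obtain t b where tb: "\<And>c. c \<in> P \<Longrightarrow> b \<le> snd c \<and> snd c \<le> t"
    unfolding bdd_above_def bdd_below_def by (metis imageI)
  \<comment> \<open>Heights \<open>b\<close> to \<open>t\<close> inclusive; row \<open>i\<close>
    lies at height \<open>t - int i\<close>, so indices increase downward.\<close>
  define n where "n = nat (t - b + 1)"
  have n: "t - int n < y \<and> y \<le> t" if "(x, y) \<in> P" for x y
    using tb[OF that] by (simp add: n_def)
  define Q where "Q i = {x. (x, t - int i) \<in> P}" for i :: nat
  define A where "A i = {x. (x, t - int i) \<in> T_centres P}" for i :: nat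
  interpret rows A Q
  proof
    show "finite (Q i)" for i
      unfolding Q_def by (rule finite_subset[of _ "fst ` P"]) (use assms(1) in \<open>force+\<close>)
    show "{x - 1, x, x + 1} \<subseteq> Q i" if "x \<in> A i" for x i
      using that by (auto simp: A_def Q_def T_centres_def)
    show "A (Suc i) \<subseteq> Q i" for i
      by (auto simp: A_def Q_def T_centres_def)
    show "A 0 = {}"
      using n by (fastforce simp: A_def T_centres_def)
  qed
  have "T_centres P \<subseteq> P"
    by (auto simp: T_centres_def)
  then have "(\<Sum>i<n. card (A i)) = card (T_centres P)"
    unfolding A_def using n by (intro sum_card_rows finite_T_centres assms(1)) blast
  then have S: "S n \<ge> (int N)\<^sup>2"
    using assms(3) unfolding S_def by (metis of_nat_le_iff of_nat_power of_nat_sum)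
  have "(\<Sum>i<n. card (Q i)) = card P"
    unfolding Q_def using n by (intro sum_card_rows assms(1)) blast
  then have P: "(\<Sum>i<n. int (card (Q i))) = int (card P)"
    by (metis of_nat_sum)
  have N: "(int N + 1)\<^sup>2 = int ((N + 1)\<^sup>2)"
    by simp
  show "card P \<ge> (N + 1)\<^sup>2"
    using sum_card_P_ge[OF _ S] assms(2) P N by (metis of_nat_0_less_iff of_nat_le_iff)
  show "\<exists>v. P = translate v (ziggurat (N + 1))" if eq: "card P = (N + 1)\<^sup>2"
  proof -
    have "(\<Sum>i<n. int (card (Q i))) = (int N + 1)\<^sup>2"
      using P N eq by simp
    then obtain m c where m: "0 < m" and A: "\<And>k. k < N \<Longrightarrow> A (m + k) = {c - int k..c + int k}"
      using tight_rows[OF assms(2) S] by blast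
    \<comment> \<open>The apex is the cell directly above the single centre in row \<open>m\<close>,
      hence the \<open>+ 1\<close>.\<close>
    define v where "v = (c, t - int m + 1)"
    have "translate v (ziggurat (N + 1)) \<subseteq> P"
    proof
      fix d
      assume "d \<in> translate v (ziggurat (N + 1))"
      then obtain x j where d: "d = (c + x, t - int m + 1 - int j)" and j: "j \<le> N" "\<bar>x\<bar> \<le> int j"
        unfolding translate_def ziggurat_def v_def by force
      show "d \<in> P"
      proof (cases j)
        case 0
        then have "c \<in> A m" "x = 0"
          using A[of 0] assms(2) j by simp_all
        then show ?thesis
          unfolding d using 0 by (simp add: A_def T_centres_def algebra_simps)
      next
        case (Suc k)
        \<comment> \<open>Row \<open>k + 1\<close> of the ziggurat extends one cell beyond the
          centres of row \<open>m + k\<close> on each side.\<close>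
        have "c + x - 1 \<in> A (m + k) \<or> c + x \<in> A (m + k) \<or> c + x + 1 \<in> A (m + k)"
          using A[of k] Suc j by auto
        then have "c + x \<in> Q (m + k)"
          using centre[of "c + x - 1"] centre[of "c + x"] centre[of "c + x + 1"] by auto
        then show ?thesis
          unfolding d using Suc by (simp add: Q_def algebra_simps)
      qed
    qed
    \<comment> \<open>Both sets have \<open>(N + 1)\<^sup>2\<close> cells, so inclusion
      suffices.\<close>
    then have "translate v (ziggurat (N + 1)) = P"
      using assms(1) eq by (intro card_subset_eq) (simp_all add: card_translate card_ziggurat)
    then show ?thesis
      by blast
  qed
qed

theorem theorem5p1:
  fixes N :: nat
  assumes "N > 0"
  shows "smallest_containing T_tetromino (N\<^sup>2) (ziggurat (N + 1)) \<and>
         (\<forall>P. smallest_containing T_tetromino (N\<^sup>2) P \<longrightarrow>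
              (\<exists>v. P = translate v (ziggurat (N + 1))))"
proof -
  let ?Z = "ziggurat (N + 1)"
  have Z: "polyomino ?Z" "card ?Z = (N + 1)\<^sup>2" "card (instances_in T_tetromino ?Z) \<ge> N\<^sup>2"
    using polyomino_ziggurat[of "N + 1"] card_ziggurat[of "N + 1"]
    by (simp_all add: card_instances_in_T T_centres_ziggurat[simplified] card_translate card_ziggurat)
  have bound: "(N + 1)\<^sup>2 \<le> card P"
    and unique: "card P = (N + 1)\<^sup>2 \<Longrightarrow> \<exists>v. P = translate v ?Z"
    if "polyomino P" "card (instances_in T_tetromino P) \<ge> N\<^sup>2" for P
    using card_ge_of_T_centres[of P N] that assms
    by (simp_all add: polyomino_def card_instances_in_T)
  have "smallest_containing T_tetromino (N\<^sup>2) ?Z"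
    unfolding smallest_containing_def using Z bound by metis
  \<comment> \<open>Minimality compared with \<open>?Z\<close> caps the size at
    \<open>(N + 1)\<^sup>2\<close>, so \<open>bound\<close> holds with equality and
    \<open>unique\<close> applies.\<close>
  moreover have "\<exists>v. P = translate v ?Z" if "smallest_containing T_tetromino (N\<^sup>2) P" for P
    using that Z bound unique unfolding smallest_containing_def by (metis le_antisym)
  ultimately show ?thesis
    by blast
qed

end
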